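(* Let $(X,A)$ be a finitely conical compact pair, witnessed by a finite sequence $(L_i,N_i)_{i\leq n}$, where each $L_i$ is an ANR. The following statements are equivalent: (1) $(X,A)$ has the $\epsilon$-surjection property for some $\epsilon>0$; (2) all the cone pairs $\mathsf{C}(L_i,N_i)$, $i\leq n$, have the surjection property.
   Context: A compact pair $(X,A)$ consists of a compact metrizable space $X$ and a compact subset $A\subseteq X$. A compact metrizable space is an absolute neighborhood retract (ANR) if every (equivalently, some) homeomorphic copy of it in the Hilbert cube $Q=[0,1]^{\mathbb{N}}$ is a retract of an open subset of $Q$ containing it. Cones. The cone $\mathsf{C}(L)$ of a space $L$ is the quotient of $L\times[0,1]$ identifying all points $(x,0)$; their class is the tip, denoted $0$. $L$ is embedded in $\mathsf{C}(L)$ as $L\times\{1\}$, and the open cone is $\mathsf{OC}(L)=\mathsf{C}(L)\setminus L$. One has $\mathsf{C}(\emptyset)=\mathsf{OC}(\emptyset)=\emptyset$. A formal symbol $\odot$ is also used, with $\mathsf{C}(\odot)=\mathsf{OC}(\odot)=\{0\}$ (just the tip). For $N\subseteq L$ compact, the cone pair is $\mathsf{C}(L,N)=(\mathsf{C}(L),L\cup\mathsf{C}(N))$; for $N=\odot$ it is $\mathsf{C}(L,\odot)=(\mathsf{C}(L),L\cup\{0\})$. Finitely conical. A pair $(X,A)$ is finitely conical, witnessed by $(L_i,N_i)_{i\leq n}$, if the $L_i$ are compact metrizable spaces, each $N_i$ is a compact subset of $L_i$ or $N_i=\odot$, and there is a finite covering of $X$ by open sets $U_i\subseteq X$, $i\leq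 n$, with homeomorphisms $f_i:U_i\to\mathsf{OC}(L_i)$ such that $f_i(U_i\cap A)=\mathsf{OC}(N_i)$. A pair $(Z,B)$ has the surjection property if every continuous $f:Z\to Z$ with $f|_B=\mathrm{id}_B$ is surjective. Given a compatible metric $d$ on $Z$ and $\epsilon>0$, $(Z,B)$ has the $\epsilon$-surjection property if every continuous $f:Z\to Z$ with $f|_B=\mathrm{id}_B$ and $d(f(z),z)<\epsilon$ for all $z\in Z$ is surjective. (For compact pairs, whether this holds for some $\epsilon>0$ is independent of the compatible metric.) *)

theory Defs
  imports "HOL-Analysis.Analysis"
begin

definition compact_metrizable :: "'a topology \<Rightarrow> bool" where
  "compact_metrizable X \<longleftrightarrow> compact_space X \<and> metrizable_space X"

definition compact_pair :: "'a topology \<times> 'a set \<Rightarrow> bool" where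
  "compact_pair = (\<lambda>(X, A). compact_metrizable X \<and> compactin X A)"

definition compatible_metric :: "'a topology \<Rightarrow> ('a \<Rightarrow> 'a \<Rightarrow> real) \<Rightarrow> bool" where
  "compatible_metric X d \<longleftrightarrow>
     Metric_space (topspace X) d \<and> Metric_space.mtopology (topspace X) d = X"

definition hilbert_cube :: "(nat \<Rightarrow> real) topology" where
  "hilbert_cube = product_topology (\<lambda>_. top_of_set {0..1}) UNIV"

text \<open>The library's \<^const>\<open>ANR\<close> concerns sets in a type-class topology; this is the notion
  for arbitrary compact metrizable spaces.\<close>

definition compact_ANR :: "'a topology \<Rightarrow> bool" where
  "compact_ANR X \<longleftrightarrow> compact_metrizable X \<and>
     (\<forall>S. S \<subseteq> topspace hilbert_cube \<and> X homeomorphic_space subtopology hilbert_cube S \<longrightarrow>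
        (\<exists>U. openin hilbert_cube U \<and> S \<subseteq> U \<and> S retract_of_space subtopology hilbert_cube U))"

definition quotient_topology :: "'a topology \<Rightarrow> ('a \<Rightarrow> 'b) \<Rightarrow> 'b topology" where
  "quotient_topology X p =
     topology (\<lambda>U. U \<subseteq> p ` topspace X \<and> openin X {x \<in> topspace X. p x \<in> U})"

lemma openin_quotient_topology:
  "openin (quotient_topology X p) U \<longleftrightarrow>
     U \<subseteq> p ` topspace X \<and> openin X {x \<in> topspace X. p x \<in> U}"
proof -
  have "istopology (\<lambda>U. U \<subseteq> p ` topspace X \<and> openin X {x \<in> topspace X. p x \<in> U})"
    unfolding istopology_def
  proof (intro conjI allI impI)
    fix S T
    assume S: "S \<subseteq> p ` topspace X \<and> openin X {x \<in> topspace X. p x \<in> S}"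
      and T: "T \<subseteq> p ` topspace X \<and> openin X {x \<in> topspace X. p x \<in> T}"
    show "S \<inter> T \<subseteq> p ` topspace X" using S by blast
    have "{x \<in> topspace X. p x \<in> S \<inter> T} =
            {x \<in> topspace X. p x \<in> S} \<inter> {x \<in> topspace X. p x \<in> T}" by blast
    then show "openin X {x \<in> topspace X. p x \<in> S \<inter> T}" using S T by auto
  next
    fix \<K>
    assume K: "\<forall>K\<in>\<K>. K \<subseteq> p ` topspace X \<and> openin X {x \<in> topspace X. p x \<in> K}"
    show "\<Union>\<K> \<subseteq> p ` topspace X" using K by blast
    have "{x \<in> topspace X. p x \<in> \<Union>\<K>} = (\<Union>K\<in>\<K>. {x \<in> topspace X. p x \<in> K})" by blast
    then show "openin X {x \<in> topspace X. p x \<in> \<Union>\<K>}" using K by auto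
  qed
  then show ?thesis
    by (simp add: quotient_topology_def topology_inverse')
qed

lemma topspace_quotient_topology [simp]: "topspace (quotient_topology X p) = p ` topspace X"
proof -
  have "{x \<in> topspace X. p x \<in> p ` topspace X} = topspace X" by blast
  then have "openin (quotient_topology X p) (p ` topspace X)"
    by (simp add: openin_quotient_topology)
  then show ?thesis
    by (metis openin_quotient_topology openin_subset openin_topspace subset_antisym)
qed

lemma quotient_map_quotient_topology: "quotient_map X (quotient_topology X p) p"
  unfolding quotient_map_def by (simp add: openin_quotient_topology)

datatype 'a cone_point = Tip | Pt 'a real

fun cone_proj :: "'a \<times> real \<Rightarrow> 'a cone_point" where
  "cone_proj (x, t) = (if t = 0 then Tip else Pt x t)"

text \<open>The cone of the empty space is empty: its points are classes of points of the cylinder.\<close>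

definition cone_space :: "'a topology \<Rightarrow> 'a cone_point topology" where
  "cone_space L = quotient_topology (prod_topology L (top_of_set {0..1})) cone_proj"

definition cone_rim :: "'a topology \<Rightarrow> 'a cone_point set" where
  "cone_rim L = cone_proj ` (topspace L \<times> {1})"

definition open_cone :: "'a topology \<Rightarrow> 'a cone_point topology" where
  "open_cone L = subtopology (cone_space L) (topspace (cone_space L) - cone_rim L)"

text \<open>The second component \<open>N\<close> of a pair \<open>(L, N)\<close> is either a subset of \<open>L\<close> or the
  formal symbol \<open>\<odot>\<close>; its cone and open cone are regarded as subsets of the cone of \<open>L\<close>.\<close>

datatype 'a cone_base = Odot (\<open>\<odot>\<close>) | Base "'a set"

fun admissible_base :: "'a topology \<Rightarrow> 'a cone_base \<Rightarrow> bool" where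
  "admissible_base L \<odot> \<longleftrightarrow> True"
| "admissible_base L (Base K) \<longleftrightarrow> compactin L K"

fun cone_set :: "'a cone_base \<Rightarrow> 'a cone_point set" where
  "cone_set \<odot> = {Tip}"
| "cone_set (Base K) = cone_proj ` (K \<times> {0..1})"

fun open_cone_set :: "'a cone_base \<Rightarrow> 'a cone_point set" where
  "open_cone_set \<odot> = {Tip}"
| "open_cone_set (Base K) = cone_proj ` (K \<times> {0..<1})"

definition cone_pair ::
  "'a topology \<Rightarrow> 'a cone_base \<Rightarrow> 'a cone_point topology \<times> 'a cone_point set" where
  "cone_pair L N = (cone_space L, cone_rim L \<union> cone_set N)"

definition finitely_conical_witnessed ::
  "'a topology \<times> 'a set \<Rightarrow> nat \<Rightarrow> (nat \<Rightarrow> 'b topology) \<Rightarrow> (nat \<Rightarrow> 'b cone_base) \<Rightarrow> bool" where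
  "finitely_conical_witnessed = (\<lambda>(X, A) n L N.
     (\<forall>i\<le>n. compact_metrizable (L i) \<and> admissible_base (L i) (N i)) \<and>
     (\<exists>U f. (\<forall>i\<le>n. openin X (U i)) \<and> (\<Union>i\<le>n. U i) = topspace X \<and>
        (\<forall>i\<le>n. homeomorphic_map (subtopology X (U i)) (open_cone (L i)) (f i) \<and>
                f i ` (U i \<inter> A) = open_cone_set (N i))))"

definition surjection_property :: "'a topology \<times> 'a set \<Rightarrow> bool" where
  "surjection_property = (\<lambda>(Z, B).
     \<forall>f. continuous_map Z Z f \<and> (\<forall>b\<in>B. f b = b) \<longrightarrow> f ` topspace Z = topspace Z)"

definition eps_surjection_property ::
  "('a \<Rightarrow> 'a \<Rightarrow> real) \<Rightarrow> real \<Rightarrow> 'a topology \<times> 'a set \<Rightarrow> bool" where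
  "eps_surjection_property d \<epsilon> = (\<lambda>(Z, B).
     \<forall>f. continuous_map Z Z f \<and> (\<forall>b\<in>B. f b = b) \<and> (\<forall>z\<in>topspace Z. d (f z) z < \<epsilon>) \<longrightarrow>
         f ` topspace Z = topspace Z)"

end

theory Submission
  imports Defs
begin

text \<open>
  The surjection property up to \<open>\<epsilon>\<close> is local, and locally the pair is a cone pair; both directions
  transport a non-surjective map between \<open>X\<close> and a cone.

  From a cone to \<open>X\<close>: a non-surjective self-map of \<open>C(L)\<close> fixing \<open>L \<union> C(N)\<close> is shrunk towards the tip of the
  corresponding chart and extended by the identity.  The result fixes \<open>A\<close>, misses a point, and is as close
  to the identity as desired because it only moves points in a small neighbourhood of the tip
  (\<open>nonsurjective_cone_map_transfers\<close>).

  From \<open>X\<close> to a cone: a self-map of \<open>X\<close> that fixes \<open>A\<close>, is near the identity and misses a point gives, in a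
  chart around that point, a map from a slightly smaller concentric cone into the open cone.  It is
  near the identity but not equal to it on the boundary of the smaller cone.  Since \<open>L\<close> is an ANR, maps
  into \<open>L\<close> that are close to each other are homotopic, and the homotopy is stationary where
  they agree (\<open>compact_ANR_locally_equiconnected\<close>).  Interpolating along such a homotopy in a
  boundary layer makes the map the identity on the boundary.  Only the height coordinate has to be
  controlled to see that the missed point, which lies below the layer, is still missed
  (\<open>core_covered\<close>).  How near to the identity the map has to be depends on the chart and on the height of
  the missed point; compactness of \<open>X\<close> yields a uniform \<open>\<epsilon>\<close>.
\<close>

section \<open>Coordinates and dilations of a cone\<close>

definition cone_height :: "'a cone_point \<Rightarrow> real" where
  "cone_height q = (case q of Tip \<Rightarrow> 0 | Pt x t \<Rightarrow> t)"

definition cone_base_point :: "'a cone_point \<Rightarrow> 'a" where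
  "cone_base_point q = (case q of Tip \<Rightarrow> undefined | Pt x t \<Rightarrow> x)"

text \<open>Radial dilation of the whole cone, truncated at the rim.  For \<open>0 < c \<le> 1\<close> it shrinks the cone
  onto the concentric subcone of height \<open>c\<close>; for \<open>c \<ge> 1\<close> it blows the subcone of height \<open>1/c\<close>
  up to the whole cone and pushes everything above that subcone radially onto the rim.  Truncating
  makes one continuous self-map of the cone out of both, so that no subspace of the quotient
  has to be treated as a quotient in its own right.\<close>

definition cone_dilate :: "real \<Rightarrow> 'a cone_point \<Rightarrow> 'a cone_point" where
  "cone_dilate c q = (case q of Tip \<Rightarrow> Tip | Pt x t \<Rightarrow> cone_proj (x, min 1 (c * t)))"

lemma cone_height_simps [simp]:
  "cone_height Tip = 0" "cone_height (Pt x t) = t" "cone_height (cone_proj (x, t)) = t"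
  by (auto simp: cone_height_def)

lemma cone_base_point_simps [simp]:
  "cone_base_point (Pt x t) = x" "t \<noteq> 0 \<Longrightarrow> cone_base_point (cone_proj (x, t)) = x"
  by (auto simp: cone_base_point_def)

lemma cone_dilate_simps [simp]:
  "cone_dilate c Tip = Tip" "cone_dilate c (Pt x t) = cone_proj (x, min 1 (c * t))"
  "cone_dilate c (cone_proj (x, t)) = cone_proj (x, min 1 (c * t))"
  by (auto simp: cone_dilate_def)

lemma cone_height_dilate: "cone_height (cone_dilate c q) = min 1 (c * cone_height q)"
  by (cases q) auto

lemma topspace_cone_space: "topspace (cone_space L) = cone_proj ` (topspace L \<times> {0..1})"
  by (simp add: cone_space_def)

lemma cone_space_cases:
  assumes "q \<in> topspace (cone_space L)"
  obtains x t where "x \<in> topspace L" "0 \<le> t" "t \<le> 1" "q = cone_proj (x, t)"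
  using assms by (auto simp: topspace_cone_space)

lemma cone_proj_in_cone_space [simp]:
  "cone_proj (x, t) \<in> topspace (cone_space L) \<longleftrightarrow>
     (if t = 0 then L \<noteq> trivial_topology else x \<in> topspace L \<and> 0 \<le> t \<and> t \<le> 1)"
  by (auto simp: topspace_cone_space image_iff Bex_def, metis subtopology_eq_discrete_topology_empty subtopology_topspace ex_in_conv)

lemma Tip_in_cone_space [simp]: "Tip \<in> topspace (cone_space L) \<longleftrightarrow> L \<noteq> trivial_topology"
  using cone_proj_in_cone_space [of _ 0] by simp

lemma cone_height_bounds:
  assumes "q \<in> topspace (cone_space L)"
  shows "0 \<le> cone_height q" "cone_height q \<le> 1"
  using assms by (auto elim!: cone_space_cases)

lemma cone_base_point_in:
  assumes "q \<in> topspace (cone_space L)" "cone_height q \<noteq> 0"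
  shows "cone_base_point q \<in> topspace L"
  using assms by (auto elim!: cone_space_cases)

lemma cone_dilate_in:
  assumes "q \<in> topspace (cone_space L)" "0 \<le> c"
  shows "cone_dilate c q \<in> topspace (cone_space L)"
  using assms(1)
proof (cases rule: cone_space_cases)
  case (1 x t)
  then have "cone_dilate c q = cone_proj (x, min 1 (c * t))" by simp
  then show ?thesis using 1 assms(2) by (auto simp del: cone_proj.simps)
qed

lemma cone_rim_eq: "cone_rim L = {q \<in> topspace (cone_space L). cone_height q = 1}"
  by (auto simp: cone_rim_def elim!: cone_space_cases simp del: cone_proj.simps)

lemma topspace_open_cone:
  "topspace (open_cone L) = {q \<in> topspace (cone_space L). cone_height q < 1}"
  using cone_height_bounds by (fastforce simp: open_cone_def cone_rim_eq)

lemma open_cone_eq: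
  "open_cone L = subtopology (cone_space L) {q \<in> topspace (cone_space L). cone_height q < 1}"
  unfolding topspace_open_cone[symmetric] by (simp add: open_cone_def subtopology_restrict)

lemma continuous_map_cone_proj:
  "continuous_map (prod_topology L (top_of_set {0..1})) (cone_space L) cone_proj"
  unfolding cone_space_def
  by (intro quotient_imp_continuous_map quotient_map_quotient_topology)

lemma continuous_map_from_cone:
  assumes "continuous_map (prod_topology L (top_of_set {0..1})) Y (f \<circ> cone_proj)"
  shows "continuous_map (cone_space L) Y f"
  using assms continuous_compose_quotient_map[OF quotient_map_quotient_topology]
  unfolding cone_space_def by blast

lemma continuous_map_into_cone:
  assumes "continuous_map X L f" "continuous_map X euclideanreal g"
    "\<And>x. x \<in> topspace X \<Longrightarrow> g x \<in> {0..1}"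
  shows "continuous_map X (cone_space L) (\<lambda>x. cone_proj (f x, g x))"
proof -
  have "continuous_map X (prod_topology L (top_of_set {0..1})) (\<lambda>x. (f x, g x))"
    using assms by (auto simp: continuous_map_paired continuous_map_in_subtopology)
  from continuous_map_compose[OF this continuous_map_cone_proj] show ?thesis
    by (simp add: o_def)
qed

lemma continuous_map_cylinder_snd:
  "continuous_map (prod_topology L (top_of_set {0..1::real})) euclideanreal snd"
  using continuous_map_snd continuous_map_in_subtopology by blast

lemma continuous_map_cone_height: "continuous_map (cone_space L) euclideanreal cone_height"
proof (rule continuous_map_from_cone)
  show "continuous_map (prod_topology L (top_of_set {0..1})) euclideanreal (cone_height \<circ> cone_proj)"
    by (rule continuous_map_eq[OF continuous_map_cylinder_snd]) auto
qed

text \<open>Over an open \<open>V\<close> in the base, the part of the cone without tip is the image of the saturated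
  open box \<open>V \<times> (0,1]\<close> of the cylinder, hence open.\<close>

lemma continuous_map_cone_base_point:
  "continuous_map (subtopology (cone_space L) {q. 0 < cone_height q}) L cone_base_point"
  unfolding continuous_map_def
proof (intro conjI allI impI)
  show "cone_base_point \<in> topspace (subtopology (cone_space L) {q. 0 < cone_height q}) \<rightarrow> topspace L"
    using cone_base_point_in by fastforce
next
  fix V assume V: "openin L V"
  define G where "G = cone_proj ` (V \<times> {0<..1})"
  have "V \<subseteq> topspace L" using V openin_subset by blast
  then have "G \<subseteq> cone_proj ` topspace (prod_topology L (top_of_set {0..1}))"
    by (auto simp: G_def)
  moreover have "{z \<in> topspace (prod_topology L (top_of_set {0..1})). cone_proj z \<in> G} = V \<times> {0<..1}"
    using \<open>V \<subseteq> topspace L\<close> by (auto simp: G_def split: if_splits)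
  moreover have "openin (top_of_set {0..1}) {0<..1::real}"
    by (auto simp: openin_open intro!: exI[of _ "{0<..}"])
  ultimately have "openin (cone_space L) G"
    using V by (simp add: cone_space_def openin_quotient_topology openin_prod_Times_iff)
  moreover have "{q \<in> topspace (subtopology (cone_space L) {q. 0 < cone_height q}). cone_base_point q \<in> V}
      = G \<inter> {q. 0 < cone_height q}"
    using \<open>V \<subseteq> topspace L\<close>
    by (auto simp: G_def image_iff elim!: cone_space_cases simp del: cone_proj.simps split: if_splits)
  ultimately show "openin (subtopology (cone_space L) {q. 0 < cone_height q})
      {q \<in> topspace (subtopology (cone_space L) {q. 0 < cone_height q}). cone_base_point q \<in> V}"
    by (auto simp: openin_subtopology)
qed

lemma continuous_map_cone_dilate:
  assumes "0 \<le> c"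
  shows "continuous_map (cone_space L) (cone_space L) (cone_dilate c)"
proof (rule continuous_map_from_cone)
  have "continuous_map (prod_topology L (top_of_set {0..1})) (cone_space L)
          (\<lambda>z. cone_proj (fst z, min 1 (c * snd z)))"
    using assms
    by (intro continuous_map_into_cone continuous_map_fst continuous_map_real_min
        continuous_map_real_mult continuous_map_cylinder_snd) auto
  then show "continuous_map (prod_topology L (top_of_set {0..1})) (cone_space L) (cone_dilate c \<circ> cone_proj)"
    by (rule continuous_map_eq) auto
qed

lemma compact_space_cone:
  assumes "compact_space L"
  shows "compact_space (cone_space L)"
proof -
  have "compact_space (prod_topology L (top_of_set {0..1::real}))"
    using assms by (simp add: compact_space_prod_topology compact_space_subtopology)
  from image_compactin[OF this[unfolded compact_space_def] continuous_map_cone_proj]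
  show ?thesis by (simp add: compact_space_def topspace_cone_space)
qed

lemma cone_dilate_inverse:
  assumes "q \<in> topspace (cone_space L)" "0 < s" "s \<le> 1"
  shows "cone_dilate (1/s) (cone_dilate s q) = q"
  using assms(1)
proof (cases rule: cone_space_cases)
  case (1 x t)
  have "min 1 (s * t) = s * t"
    using 1 assms mult_le_one[of s t] by (simp add: min_def)
  then show ?thesis using 1 assms by (simp del: cone_proj.simps)
qed

lemma cone_dilate_inverse_below:
  assumes "q \<in> topspace (cone_space L)" "0 < s" "s \<le> 1" "cone_height q \<le> s"
  shows "cone_dilate s (cone_dilate (1/s) q) = q"
  using assms(1)
proof (cases rule: cone_space_cases)
  case (1 x t)
  have "min 1 (1/s * t) = t / s"
    using 1 assms by (auto simp: min_def field_simps)
  then show ?thesis using 1 assms by (auto simp del: cone_proj.simps)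
qed

text \<open>Blowing up loses information only on what is pushed to the rim, so a point strictly below
  height \<open>s\<close> remains the only point with its image.\<close>

lemma cone_dilate_inj_below:
  assumes "p \<in> topspace (cone_space L)" "q \<in> topspace (cone_space L)" "0 < s" "s \<le> 1"
    and "cone_height p < s" and eq: "cone_dilate (1/s) q = cone_dilate (1/s) p"
  shows "q = p"
proof -
  have "min 1 (1/s * cone_height q) = min 1 (1/s * cone_height p)"
    using eq by (metis cone_height_dilate)
  moreover have "1/s * cone_height p < 1" using assms by simp
  ultimately have "1/s * cone_height q < 1" by (auto simp: min_def split: if_splits)
  then have "cone_height q < s" using assms by (simp add: field_simps)
  then show ?thesis
    using assms cone_dilate_inverse_below by (metis less_imp_le)
qed

lemma cone_dilate_cone_set:
  assumes "q \<in> cone_set N" "0 \<le> c"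
  shows "cone_dilate c q \<in> cone_set N"
proof (cases N)
  case Odot
  then show ?thesis using assms by simp
next
  case (Base K)
  then obtain x t where "x \<in> K" "0 \<le> t" "q = cone_proj (x, t)"
    using assms by auto
  then have "cone_dilate c q = cone_proj (x, min 1 (c * t))" "(x, min 1 (c * t)) \<in> K \<times> {0..1}"
    using assms by auto
  then show ?thesis using Base by (simp del: cone_proj.simps)
qed

lemma open_cone_set_eq: "open_cone_set N = {q \<in> cone_set N. cone_height q < 1}"
proof (cases N)
  case (Base K)
  have "cone_proj ` (K \<times> {0..<1}) = {q \<in> cone_proj ` (K \<times> {0..1}). cone_height q < 1}"
    by (force simp del: cone_proj.simps)
  then show ?thesis using Base by simp
qed auto

text \<open>The preimage in the cylinder of a neighbourhood of the tip contains \<open>L \<times> {0}\<close>, so the tube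
  lemma applies to the compact base.\<close>

lemma cone_neighbourhood_of_tip:
  assumes "compact_space L" "openin (cone_space L) G" "Tip \<in> G"
  obtains s where "0 < s" "s < 1" "\<And>q. \<lbrakk>q \<in> topspace (cone_space L); cone_height q \<le> s\<rbrakk> \<Longrightarrow> q \<in> G"
proof -
  let ?P = "prod_topology L (top_of_set {0..1::real})"
  define T where "T = {z \<in> topspace ?P. cone_proj z \<in> G}"
  have "openin ?P T"
    unfolding T_def by (rule openin_continuous_map_preimage[OF continuous_map_cone_proj assms(2)])
  moreover have "topspace L \<times> {0} \<subseteq> T" using assms(3) by (auto simp: T_def)
  ultimately obtain V' V where V: "openin (top_of_set {0..1::real}) V" "0 \<in> V" "topspace L \<subseteq> V'" "V' \<times> V \<subseteq> T"
    using tube_lemma_left[of L "top_of_set {0..1}" T "topspace L" 0] assms(1)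
    by (auto simp: compact_space_def)
  then obtain e where e: "0 < e" "\<And>t. \<lbrakk>t \<in> {0..1}; dist t 0 < e\<rbrakk> \<Longrightarrow> t \<in> V"
    by (metis openin_euclidean_subtopology_iff)
  show thesis
  proof
    show "0 < min (1/2) (e/2)" "min (1/2) (e/2) < 1" using e by auto
    fix q assume q: "q \<in> topspace (cone_space L)" "cone_height q \<le> min (1/2) (e/2)"
    from q(1) obtain x t where xt: "x \<in> topspace L" "0 \<le> t" "t \<le> 1" "q = cone_proj (x, t)"
      by (rule cone_space_cases)
    then have "t \<le> e/2" using q(2) by (simp del: cone_proj.simps)
    then have "t \<in> V" using xt e by auto
    then have "(x, t) \<in> T" using V xt by blast
    then show "q \<in> G" by (simp add: T_def xt del: cone_proj.simps)
  qed
qed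

section \<open>Compact ANRs are locally equiconnected\<close>

text \<open>The coordinates of the embedding are the truncated distances to the points of a countable dense
  set, obtained from finite \<open>1/(k+1)\<close>-nets.  Two distinct points are separated by the distance to
  a net point very close to one of them; compactness does the rest.\<close>

lemma compact_metrizable_embeds_hilbert_cube:
  assumes "compact_metrizable L"
  obtains e where "embedding_map L hilbert_cube e"
proof (cases "topspace L = {}")
  case True
  then have "embedding_map L hilbert_cube (\<lambda>_. undefined)"
    by (intro continuous_imp_embedding_map) (auto simp: hilbert_cube_def Hausdorff_space_product_topology Hausdorff_space_subtopology)
  then show thesis by (rule that)
next
  case False
  obtain m where L: "L = mtopology_of m"
    using assms unfolding compact_metrizable_def metrizable_space_def mtopology_of_def
    by (metis Metric_space.mdist_metric Metric_space.mspace_metric)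
  have top: "topspace L = mspace m" using L by simp
  interpret Metric_space "mspace m" "mdist m" by simp
  have "compactin mtopology (mspace m)"
    using assms by (simp add: compact_metrizable_def compact_space_def L mtopology_of_def)
  then have "mtotally_bounded (mspace m)" by (rule compactin_imp_mtotally_bounded)
  then have "\<forall>k::nat. \<exists>K. finite K \<and> K \<subseteq> mspace m \<and> mspace m \<subseteq> (\<Union>x\<in>K. mball x (inverse (Suc k)))"
    unfolding mtotally_bounded_def by simp
  then obtain K where K: "\<And>k::nat. finite (K k)" "\<And>k. K k \<subseteq> mspace m"
      "\<And>k. mspace m \<subseteq> (\<Union>x\<in>K k. mball x (inverse (Suc k)))"
    by metis
  define D where "D = (\<Union>k. K k)"
  have "countable D" using K(1) by (simp add: D_def countable_finite)
  have "mspace m \<noteq> {}" using False top by metis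
  then have "D \<noteq> {}" using K(3)[of 0] unfolding D_def by blast
  define a where "a = from_nat_into D"
  have range: "range a = D" unfolding a_def by (rule range_from_nat_into) fact+
  then have a_in: "a j \<in> mspace m" for j using range K(2) unfolding D_def by blast
  define e where "e = (\<lambda>p j. min 1 (mdist m (a j) p))"
  have "continuous_map L hilbert_cube e"
    unfolding hilbert_cube_def continuous_map_componentwise_UNIV continuous_map_in_subtopology
  proof (intro allI conjI)
    fix j
    show "continuous_map L euclideanreal (\<lambda>p. e p j)"
      unfolding e_def L using a_in by (intro continuous_map_real_min continuous_on_mdist) auto
    show "(\<lambda>p. e p j) \<in> topspace L \<rightarrow> {0..1}" by (auto simp: e_def)
  qed
  moreover have "inj_on e (topspace L)"
  proof (rule inj_onI, rule ccontr)
    fix p q assume pq: "p \<in> topspace L" "q \<in> topspace L" "e p = e q" "p \<noteq> q"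
    then have "mdist m p q > 0" by (simp add: top)
    then obtain k where k: "inverse (real (Suc k)) < min 1 (mdist m p q / 2)"
      using reals_Archimedean by (metis less_divide_eq_numeral1(1) min_less_iff_conj mult_zero_left zero_less_one)
    obtain x where x: "x \<in> K k" "p \<in> mball x (inverse (Suc k))"
      using K(3)[of k] pq top by auto
    then have "x \<in> range a" unfolding range D_def by blast
    then obtain j where j: "x = a j" by blast
    have "mdist m x p < inverse (Suc k)" using x by simp
    moreover have "min 1 (mdist m x p) = min 1 (mdist m x q)"
      using fun_cong[OF pq(3), of j] by (simp add: e_def j)
    moreover have "mdist m p q \<le> mdist m x p + mdist m x q"
      using pq top a_in[of j] j by (metis commute triangle)
    ultimately show False using k by (auto simp: min_def split: if_splits)
  qed
  ultimately have "embedding_map L hilbert_cube e"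
    using assms by (intro continuous_imp_embedding_map)
      (auto simp: hilbert_cube_def compact_metrizable_def Hausdorff_space_product_topology Hausdorff_space_subtopology)
  then show thesis by (rule that)
qed

text \<open>Points of an ANR that are close to each other can be joined by paths that depend continuously on
  the endpoints and are constant when the endpoints agree: in the Hilbert cube, join the points
  by the straight segment and retract it back.  \<open>W\<close> is the set of pairs whose
  segment stays inside the domain of the retraction.\<close>

lemma compact_ANR_locally_equiconnected:
  assumes "compact_ANR L"
  obtains W E where "openin (prod_topology L L) W" "\<And>x. x \<in> topspace L \<Longrightarrow> (x, x) \<in> W"
    "continuous_map (prod_topology (subtopology (prod_topology L L) W) (top_of_set {0..1::real})) L E"
    "\<And>x y. (x, y) \<in> W \<Longrightarrow> E ((x, y), 0) = x"
    "\<And>x y. (x, y) \<in> W \<Longrightarrow> E ((x, y), 1) = y"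
    "\<And>x t. \<lbrakk>x \<in> topspace L; 0 \<le> t; t \<le> 1\<rbrakk> \<Longrightarrow> E ((x, x), t) = x"
proof -
  let ?I = "top_of_set {0..1::real}"
  have cm: "compact_metrizable L" using assms by (simp add: compact_ANR_def)
  obtain e where e: "embedding_map L hilbert_cube e"
    using compact_metrizable_embeds_hilbert_cube cm by blast
  define S where "S = e ` topspace L"
  have e_cont: "continuous_map L hilbert_cube e"
    using e unfolding embedding_map_def
    by (metis continuous_map_in_subtopology homeomorphic_imp_continuous_map)
  then have S: "S \<subseteq> topspace hilbert_cube"
    by (simp add: S_def continuous_map_image_subset_topspace)
  have "homeomorphic_map L (subtopology hilbert_cube S) e"
    using e by (simp add: embedding_map_def S_def)
  then obtain e' where e': "homeomorphic_maps L (subtopology hilbert_cube S) e e'"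
    by (auto simp: homeomorphic_map_maps)
  then have "L homeomorphic_space subtopology hilbert_cube S"
    by (auto simp: homeomorphic_space_def)
  with assms S obtain U where U: "openin hilbert_cube U" "S \<subseteq> U"
      "S retract_of_space subtopology hilbert_cube U"
    unfolding compact_ANR_def by blast
  then obtain r where r: "continuous_map (subtopology hilbert_cube U) (subtopology hilbert_cube S) r"
      "\<And>x. x \<in> S \<Longrightarrow> r x = x"
    by (auto simp: retract_of_space_def subtopology_subtopology Int_absorb1)
  let ?P = "prod_topology (prod_topology L L) ?I"
  define m where "m = (\<lambda>((x, y), t::real) j::nat. (1 - t) * e x j + t * e y j)"
  have e_coord: "continuous_map L euclideanreal (\<lambda>x. e x j)"
    and e_range: "x \<in> topspace L \<Longrightarrow> e x j \<in> {0..1}" for x j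
    using e_cont unfolding hilbert_cube_def continuous_map_componentwise_UNIV continuous_map_in_subtopology
    by (blast, blast)
  have m_cont: "continuous_map ?P hilbert_cube m"
    unfolding hilbert_cube_def continuous_map_componentwise_UNIV continuous_map_in_subtopology
  proof (intro allI conjI)
    fix j
    have t: "continuous_map ?P euclideanreal snd"
      using continuous_map_snd continuous_map_in_subtopology by blast
    have "continuous_map ?P euclideanreal (\<lambda>z. (1 - snd z) * e (fst (fst z)) j + snd z * e (snd (fst z)) j)"
      by (intro continuous_map_add continuous_map_real_mult continuous_map_diff t
          continuous_map_compose[OF _ e_coord, unfolded o_def]
          continuous_map_compose[OF continuous_map_fst continuous_map_fst, unfolded o_def]
          continuous_map_compose[OF continuous_map_fst continuous_map_snd, unfolded o_def]) auto
    then show "continuous_map ?P euclideanreal (\<lambda>z. m z j)"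
      by (simp add: m_def case_prod_unfold)
    have "(1 - t) * u + t * v \<in> {0..1}" if "t \<in> {0..1}" "u \<in> {0..1}" "v \<in> {0..1}" for t u v :: real
      using that convex_bound_le[of u 1 v "1 - t" t] by auto
    then show "(\<lambda>z. m z j) \<in> topspace ?P \<rightarrow> {0..1}"
      using e_range by (auto simp: m_def simp del: atLeastAtMost_iff)
  qed
  define O' where "O' = {z \<in> topspace ?P. m z \<in> U}"
  have O': "openin ?P O'"
    unfolding O'_def by (rule openin_continuous_map_preimage[OF m_cont U(1)])
  \<comment> \<open>\<open>W\<close> is open since projection along the compact factor \<open>[0,1]\<close> is a closed map.\<close>
  define W where "W = topspace (prod_topology L L) - fst ` (topspace ?P - O')"
  have "closedin ?P (topspace ?P - O')" using O' by blast
  moreover have "closed_map ?P (prod_topology L L) fst"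
    by (intro closed_map_fst) (simp add: compact_space_subtopology)
  ultimately have "closedin (prod_topology L L) (fst ` (topspace ?P - O'))"
    unfolding closed_map_def by blast
  then have W: "openin (prod_topology L L) W"
    unfolding W_def by blast
  have W_O': "(w, t) \<in> O'" if "w \<in> W" "t \<in> {0..1}" for w t
  proof (rule ccontr)
    assume "(w, t) \<notin> O'"
    with that have "(w, t) \<in> topspace ?P - O'" by (simp add: W_def)
    then have "fst (w, t) \<in> fst ` (topspace ?P - O')" by (rule imageI)
    then show False using that by (simp add: W_def)
  qed
  have W_sub: "x \<in> topspace L" "y \<in> topspace L" if "(x, y) \<in> W" for x y
    using that by (auto simp: W_def)
  have m_diag: "m ((x, x), t) = e x" for x t
    by (simp add: m_def fun_eq_iff left_diff_distrib)
  have S_in: "e x \<in> S" if "x \<in> topspace L" for x using that by (simp add: S_def)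
  have e'_e: "e' (e x) = x" if "x \<in> topspace L" for x
    using e' that by (simp add: homeomorphic_maps_def)
  define E where "E = e' \<circ> r \<circ> m"
  show thesis
  proof
    show "openin (prod_topology L L) W" by (rule W)
    show "(x, x) \<in> W" if "x \<in> topspace L" for x
    proof -
      have "z \<in> O'" if z: "z \<in> topspace ?P" "fst z = (x, x)" for z
      proof -
        obtain t where "z = ((x, x), t)" using z(2) by (metis prod.collapse)
        then have "m z = e x" by (simp only: m_diag)
        then show ?thesis
          using z(1) S_in[OF \<open>x \<in> topspace L\<close>] U(2) unfolding O'_def by auto
      qed
      then have "(x, x) \<notin> fst ` (topspace ?P - O')" by fastforce
      then show ?thesis using that by (simp add: W_def)
    qed
    show "continuous_map (prod_topology (subtopology (prod_topology L L) W) ?I) L E"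
      unfolding E_def
    proof -
      have "prod_topology (subtopology (prod_topology L L) W) ?I = subtopology ?P (W \<times> {0..1})"
        by (simp add: prod_topology_subtopology(1))
      moreover have "m ` topspace (subtopology ?P (W \<times> {0..1})) \<subseteq> U"
      proof (rule image_subsetI)
        fix z assume "z \<in> topspace (subtopology ?P (W \<times> {0..1}))"
        then obtain w t where "z = (w, t)" "w \<in> W" "t \<in> {0..1}" by auto
        then have "z \<in> O'" using W_O' by blast
        then show "m z \<in> U" by (simp add: O'_def)
      qed
      ultimately have "continuous_map (prod_topology (subtopology (prod_topology L L) W) ?I) (subtopology hilbert_cube U) m"
        using m_cont by (simp add: continuous_map_in_subtopology continuous_map_from_subtopology image_subset_iff_funcset)
      moreover have "continuous_map (subtopology hilbert_cube S) L e'"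
        using e' by (simp add: homeomorphic_maps_def)
      ultimately show "continuous_map (prod_topology (subtopology (prod_topology L L) W) ?I) L (e' \<circ> r \<circ> m)"
        using r(1) by (metis continuous_map_compose)
    qed
    show "E ((x, y), 0) = x" if "(x, y) \<in> W" for x y
    proof -
      have "m ((x, y), 0) = e x" by (auto simp: m_def)
      then show ?thesis using W_sub[OF that] by (simp add: E_def S_in r e'_e)
    qed
    show "E ((x, y), 1) = y" if "(x, y) \<in> W" for x y
    proof -
      have "m ((x, y), 1) = e y" by (auto simp: m_def)
      then show ?thesis using W_sub[OF that] by (simp add: E_def S_in r e'_e)
    qed
    show "E ((x, x), t) = x" if "x \<in> topspace L" for x t
      using that by (simp add: E_def m_diag S_in r e'_e)
  qed
qed

section \<open>Conical charts\<close>

locale conical_chart =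
  fixes X :: "'a topology" and U :: "'a set" and L :: "'b topology"
    and \<phi> :: "'a \<Rightarrow> 'b cone_point" and \<psi> :: "'b cone_point \<Rightarrow> 'a"
  assumes Hausdorff_X: "Hausdorff_space X" and open_U: "openin X U"
    and compact_L: "compact_space L"
    and maps: "homeomorphic_maps (subtopology X U) (open_cone L) \<phi> \<psi>"
begin

abbreviation height :: "'a \<Rightarrow> real" where
  "height z \<equiv> cone_height (\<phi> z)"

lemma U_subset: "U \<subseteq> topspace X"
  using open_U by (rule openin_subset)

lemma chart_in: "\<phi> z \<in> topspace (cone_space L)" "height z < 1" "0 \<le> height z" if "z \<in> U"
proof -
  have "\<phi> z \<in> topspace (open_cone L)"
    using maps that U_subset unfolding homeomorphic_maps_def continuous_map_def by auto
  then show "\<phi> z \<in> topspace (cone_space L)" "height z < 1"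
    by (auto simp: topspace_open_cone)
  then show "0 \<le> height z" by (simp add: cone_height_bounds)
qed

lemma inverse_chart_in: "\<psi> q \<in> U" if "q \<in> topspace (cone_space L)" "cone_height q < 1"
proof -
  have "q \<in> topspace (open_cone L)" using that by (simp add: topspace_open_cone)
  then show ?thesis
    using maps unfolding homeomorphic_maps_def continuous_map_def by auto
qed

lemma inverse_chart_chart [simp]: "\<psi> (\<phi> z) = z" if "z \<in> U"
  using maps that U_subset unfolding homeomorphic_maps_def by auto

lemma chart_inverse_chart: "\<phi> (\<psi> q) = q" if "q \<in> topspace (cone_space L)" "cone_height q < 1"
  using maps that unfolding homeomorphic_maps_def by (auto simp: topspace_open_cone)

lemma continuous_map_chart: "continuous_map (subtopology X U) (cone_space L) \<phi>"
  using maps unfolding homeomorphic_maps_def open_cone_eq continuous_map_in_subtopology by blast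

lemma openin_chart_preimage: "openin X {z \<in> U. \<phi> z \<in> G}" if "openin (cone_space L) G"
proof -
  have "openin (subtopology X U) {z \<in> topspace (subtopology X U). \<phi> z \<in> G}"
    by (rule openin_continuous_map_preimage[OF continuous_map_chart that])
  moreover have "topspace (subtopology X U) = U" using U_subset by auto
  ultimately show ?thesis
    using open_U by (auto simp only: openin_open_subtopology)
qed

lemma dilate_into_chart:
  assumes "q \<in> topspace (cone_space L)" "0 \<le> b" "b < 1"
  shows "cone_dilate b q \<in> topspace (cone_space L)" "cone_height (cone_dilate b q) \<le> b"
    "cone_height (cone_dilate b q) < 1" "\<psi> (cone_dilate b q) \<in> U"
    "\<phi> (\<psi> (cone_dilate b q)) = cone_dilate b q"
    "cone_height (cone_dilate b q) = b * cone_height q"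
proof -
  show 1: "cone_dilate b q \<in> topspace (cone_space L)" using assms by (simp add: cone_dilate_in)
  have "b * cone_height q \<le> b"
    using assms cone_height_bounds[OF assms(1)] by (simp add: mult_left_le)
  then show 2: "cone_height (cone_dilate b q) \<le> b" "cone_height (cone_dilate b q) = b * cone_height q"
    using assms by (auto simp: cone_height_dilate)
  then show 3: "cone_height (cone_dilate b q) < 1" using assms by linarith
  show "\<psi> (cone_dilate b q) \<in> U" using 1 3 by (rule inverse_chart_in)
  show "\<phi> (\<psi> (cone_dilate b q)) = cone_dilate b q" using 1 3 by (rule chart_inverse_chart)
qed

lemma continuous_map_inverse_chart_dilate:
  assumes "0 \<le> b" "b < 1"
  shows "continuous_map (cone_space L) X (\<lambda>q. \<psi> (cone_dilate b q))"
proof -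
  have "continuous_map (cone_space L) (open_cone L) (cone_dilate b)"
    unfolding open_cone_eq continuous_map_in_subtopology
    using continuous_map_cone_dilate[OF assms(1)] dilate_into_chart[OF _ assms] by auto
  moreover have "continuous_map (open_cone L) X \<psi>"
    using maps unfolding homeomorphic_maps_def continuous_map_in_subtopology by blast
  ultimately have "continuous_map (cone_space L) X (\<psi> \<circ> cone_dilate b)"
    by (rule continuous_map_compose)
  then show ?thesis by (simp add: o_def)
qed

lemma core_eq_image:
  assumes "0 < s" "s < 1"
  shows "{z \<in> U. height z \<le> s} = (\<lambda>q. \<psi> (cone_dilate s q)) ` topspace (cone_space L)"
proof (intro equalityI subsetI)
  fix z assume z: "z \<in> {z \<in> U. height z \<le> s}"
  then have "cone_dilate s (cone_dilate (1/s) (\<phi> z)) = \<phi> z"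
    using assms chart_in by (intro cone_dilate_inverse_below) auto
  then have "z = \<psi> (cone_dilate s (cone_dilate (1/s) (\<phi> z)))" using z by simp
  moreover have "cone_dilate (1/s) (\<phi> z) \<in> topspace (cone_space L)"
    using z assms chart_in by (intro cone_dilate_in) auto
  ultimately show "z \<in> (\<lambda>q. \<psi> (cone_dilate s q)) ` topspace (cone_space L)" by blast
next
  fix z assume "z \<in> (\<lambda>q. \<psi> (cone_dilate s q)) ` topspace (cone_space L)"
  then show "z \<in> {z \<in> U. height z \<le> s}" using assms dilate_into_chart by auto
qed

lemma compactin_core:
  assumes "0 < s" "s < 1"
  shows "compactin X {z \<in> U. height z \<le> s}"
  unfolding core_eq_image[OF assms]
  using compact_space_cone[OF compact_L] continuous_map_inverse_chart_dilate[of s] assms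
  by (auto simp: compact_space_def intro: image_compactin)

lemma closedin_core: "\<lbrakk>0 < s; s < 1\<rbrakk> \<Longrightarrow> closedin X {z \<in> U. height z \<le> s}"
  using compactin_core Hausdorff_X compactin_imp_closedin by blast

lemma openin_open_core: "openin X {z \<in> U. height z < s}"
proof -
  have "openin (cone_space L) {q \<in> topspace (cone_space L). cone_height q \<in> {..<s}}"
    by (rule openin_continuous_map_preimage[OF continuous_map_cone_height]) simp
  from openin_chart_preimage[OF this] show ?thesis
    using chart_in by (auto elim!: back_subst[of "openin X"])
qed

lemma small_core:
  assumes "openin X V" "\<psi> Tip \<in> V" "L \<noteq> trivial_topology"
  obtains s where "0 < s" "s < 1" "{z \<in> U. height z \<le> s} \<subseteq> V"
proof -
  define G where "G = {q \<in> topspace (cone_space L). \<psi> (cone_dilate (1/2) q) \<in> V}"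
  have "openin (cone_space L) G" unfolding G_def
    by (rule openin_continuous_map_preimage[OF continuous_map_inverse_chart_dilate assms(1)]) auto
  moreover have "Tip \<in> G" using assms by (simp add: G_def)
  ultimately obtain s where s: "0 < s" "s < 1"
      "\<And>q. \<lbrakk>q \<in> topspace (cone_space L); cone_height q \<le> s\<rbrakk> \<Longrightarrow> q \<in> G"
    using cone_neighbourhood_of_tip[OF compact_L] by blast
  show thesis
  proof
    show "0 < s / 2" "s / 2 < 1" using s by auto
    show "{z \<in> U. height z \<le> s / 2} \<subseteq> V"
    proof clarify
      fix z assume z: "z \<in> U" "height z \<le> s / 2"
      \<comment> \<open>The set \<open>G\<close> speaks of the half-scaled chart, so \<open>z\<close> is tested at its doubled coordinate.\<close>
      let ?q = "cone_dilate (1/(1/2)) (\<phi> z)"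
      have "?q \<in> G"
        using z s(2) chart_in[OF z(1)] by (intro s(3) cone_dilate_in) (auto simp: cone_height_dilate)
      moreover have "cone_dilate (1/2) ?q = \<phi> z"
        using z s(2) chart_in[OF z(1)] by (intro cone_dilate_inverse_below) auto
      ultimately show "z \<in> V" using z by (simp add: G_def)
    qed
  qed
qed

text \<open>A cone map fixing the rim can be copied at scale \<open>s\<close> into the core of height \<open>s\<close> and
  extended by the identity, since it agrees with the identity on the sphere of height \<open>s\<close>.
  The extension moves points only inside the core, which lies in any prescribed
  neighbourhood \<open>V\<close> of the tip once \<open>s\<close> is small; the copy of the missed point stays missed because it
  lies strictly below height \<open>s\<close> and the points outside the core do not move.\<close>

lemma nonsurjective_cone_map_transfers:
  assumes g: "continuous_map (cone_space L) (cone_space L) g"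
    "\<And>q. q \<in> cone_rim L \<Longrightarrow> g q = q" "\<And>q. q \<in> cone_set N \<Longrightarrow> g q = q"
    and miss: "p \<in> topspace (cone_space L)" "p \<notin> g ` topspace (cone_space L)"
    and A: "\<phi> ` (U \<inter> A) = open_cone_set N"
    and V: "openin X V" "\<psi> Tip \<in> V"
  obtains f where "continuous_map X X f" "\<And>a. a \<in> A \<Longrightarrow> f a = a"
    "f ` topspace X \<noteq> topspace X"
    "\<And>z. z \<in> topspace X \<Longrightarrow> f z = z \<or> z \<in> V \<and> f z \<in> V"
proof -
  have "L \<noteq> trivial_topology" using miss(1) by (auto simp: topspace_cone_space)
  then obtain s where s: "0 < s" "s < 1" and core_V: "{z \<in> U. height z \<le> s} \<subseteq> V"
    using small_core V by blast
  define core where "core = {z \<in> U. height z \<le> s}"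
  define h where "h = (\<lambda>z. \<psi> (cone_dilate s (g (cone_dilate (1/s) (\<phi> z)))))"
  define f where "f = (\<lambda>z. if z \<in> core then h z else z)"
  have up_in: "cone_dilate (1/s) (\<phi> z) \<in> topspace (cone_space L)" if "z \<in> U" for z
    using that s chart_in by (intro cone_dilate_in) auto
  have g_in: "g q \<in> topspace (cone_space L)" if "q \<in> topspace (cone_space L)" for q
    using g(1) that unfolding continuous_map_def by auto
  have down_up: "cone_dilate s (cone_dilate (1/s) (\<phi> z)) = \<phi> z" if "z \<in> core" for z
    using that s chart_in unfolding core_def by (intro cone_dilate_inverse_below) auto
  have h_core: "h z \<in> core" if "z \<in> U" for z
    using dilate_into_chart[OF g_in[OF up_in[OF that]]] s by (auto simp: h_def core_def)
  have h_fixed: "h z = z" if "z \<in> core" "g (cone_dilate (1/s) (\<phi> z)) = cone_dilate (1/s) (\<phi> z)" for z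
    using that down_up by (simp add: h_def core_def)
  have h_level: "h z = z" if "z \<in> U" "height z = s" for z
  proof (rule h_fixed)
    show "z \<in> core" using that by (simp add: core_def)
    show "g (cone_dilate (1/s) (\<phi> z)) = cone_dilate (1/s) (\<phi> z)"
      using that s up_in by (intro g(2)) (auto simp: cone_rim_eq cone_height_dilate)
  qed
  have h_cont: "continuous_map (subtopology X U) X h"
  proof -
    have "continuous_map (subtopology X U) X
        ((\<lambda>q. \<psi> (cone_dilate s q)) \<circ> (g \<circ> (cone_dilate (1/s) \<circ> \<phi>)))"
      using s by (intro continuous_map_compose[OF _ continuous_map_inverse_chart_dilate]
          continuous_map_compose[OF _ g(1)] continuous_map_compose[OF continuous_map_chart]
          continuous_map_cone_dilate) auto
    then show ?thesis by (simp add: h_def o_def)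
  qed
  have f_cont: "continuous_map X X f"
  proof (rule pasting_lemma_closed[where I = UNIV and f = "\<lambda>b. if b then h else id"
        and T = "\<lambda>b. if b then core else topspace X - {z \<in> U. height z < s}"])
    show "closedin X (if b then core else topspace X - {z \<in> U. height z < s})" for b
      using closedin_core[OF s] openin_open_core[of s] by (auto simp: core_def)
    show "continuous_map (subtopology X (if b then core else topspace X - {z \<in> U. height z < s})) X
        (if b then h else id)" for b
    proof -
      have "continuous_map (subtopology X core) X h"
        by (rule continuous_map_from_subtopology_mono[OF h_cont]) (auto simp: core_def)
      then show ?thesis by (simp add: continuous_map_from_subtopology)
    qed
    fix i j z
    assume "z \<in> topspace X \<inter> (if i then core else topspace X - {z \<in> U. height z < s}) \<inter>
        (if j then core else topspace X - {z \<in> U. height z < s})"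
    then show "(if i then h else id) z = (if j then h else id) z"
      using h_level by (auto simp: core_def)
  next
    fix z assume "z \<in> topspace X"
    then show "\<exists>j. j \<in> UNIV \<and> z \<in> (if j then core else topspace X - {z \<in> U. height z < s}) \<and>
        f z = (if j then h else id) z"
      by (intro exI[of _ "z \<in> core"]) (auto simp: f_def core_def)
  qed auto
  have f_A: "f a = a" if "a \<in> A" for a
  proof (cases "a \<in> core")
    case True
    then have "\<phi> a \<in> open_cone_set N" using that A by (auto simp: core_def)
    then have "cone_dilate (1/s) (\<phi> a) \<in> cone_set N"
      using s by (intro cone_dilate_cone_set) (auto simp: open_cone_set_eq)
    then show ?thesis using True g(3) h_fixed by (simp add: f_def)
  qed (simp add: f_def)
  have f_miss: "\<psi> (cone_dilate s p) \<notin> f ` topspace X"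
  proof
    assume "\<psi> (cone_dilate s p) \<in> f ` topspace X"
    then obtain z where z: "z \<in> topspace X" "f z = \<psi> (cone_dilate s p)" by auto
    have "p \<notin> cone_rim L" using miss g(2) by (metis imageI)
    then have p_rim: "cone_height p < 1"
      using miss(1) cone_height_bounds[OF miss(1)] by (simp add: cone_rim_eq)
    have chart_p: "\<phi> (f z) = cone_dilate s p"
      using dilate_into_chart[OF miss(1)] s z by simp
    have fz: "f z \<in> U" "height (f z) < s"
      using dilate_into_chart[OF miss(1)] s z p_rim by auto
    have "z \<in> core" using fz by (auto simp: f_def core_def split: if_splits)
    let ?q = "g (cone_dilate (1/s) (\<phi> z))"
    have zU: "z \<in> U" using \<open>z \<in> core\<close> by (simp add: core_def)
    have "f z = \<psi> (cone_dilate s ?q)" using \<open>z \<in> core\<close> by (simp add: f_def h_def)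
    then have "cone_dilate s ?q = cone_dilate s p"
      using chart_p dilate_into_chart(5)[OF g_in[OF up_in[OF zU]], of s] s by simp
    then have "?q = p"
      using cone_dilate_inverse[OF miss(1), of s] cone_dilate_inverse[OF g_in[OF up_in[OF zU]], of s] s by simp
    then show False using miss(2) up_in[OF zU] by blast
  qed
  show thesis
  proof
    show "continuous_map X X f" by (rule f_cont)
    show "f a = a" if "a \<in> A" for a using that by (rule f_A)
    show "f ` topspace X \<noteq> topspace X"
      using f_miss dilate_into_chart(4)[OF miss(1), of s] s U_subset by auto
    show "f z = z \<or> z \<in> V \<and> f z \<in> V" if "z \<in> topspace X" for z
      using core_V h_core by (auto simp: f_def core_def)
  qed
qed

text \<open>A Lebesgue number argument on the compact core of height \<open>b\<close>.  Points that are close to each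
  other in \<open>X\<close> have close cone coordinates; the base coordinate makes sense only away from the
  tip, so nothing is asserted about it below height \<open>a\<close>.\<close>

lemma close_points_share_coordinates:
  assumes d: "compatible_metric X d"
    and W: "openin (prod_topology L L) W" "\<And>x. x \<in> topspace L \<Longrightarrow> (x, x) \<in> W"
    and sab: "0 \<le> s" "s < a" "0 < b" "b < 1"
  obtains \<epsilon> where "0 < \<epsilon>"
    "\<And>y z. \<lbrakk>y \<in> topspace X; z \<in> U; height z \<le> b; d y z < \<epsilon>\<rbrakk> \<Longrightarrow>
       y \<in> U \<and> (height z < a \<or> s < height y \<and> (cone_base_point (\<phi> y), cone_base_point (\<phi> z)) \<in> W)"
proof -
  interpret Metric_space "topspace X" d using d by (simp add: compatible_metric_def)
  have mtop: "mtopology = X" using d by (simp add: compatible_metric_def)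
  define P where "P = (\<lambda>y z. y \<in> U \<and>
     (height z < a \<or> s < height y \<and> (cone_base_point (\<phi> y), cone_base_point (\<phi> z)) \<in> W))"
  define \<C> where "\<C> = {V. openin X V \<and> (\<forall>y\<in>V. \<forall>z\<in>V. P y z)}"
  have "\<exists>V\<in>\<C>. z0 \<in> V" if z0: "z0 \<in> U" for z0
  proof (cases "height z0 < a")
    case True
    then show ?thesis
      using z0 openin_open_core[of a] by (intro bexI[of _ "{z \<in> U. height z < a}"]) (auto simp: \<C>_def P_def)
  next
    case False
    let ?C = "cone_space L"
    let ?x = "cone_base_point (\<phi> z0)"
    have x: "?x \<in> topspace L" using False sab chart_in[OF z0] by (intro cone_base_point_in) auto
    then obtain V1 V2 where V12: "openin L V1" "openin L V2" "?x \<in> V1" "?x \<in> V2" "V1 \<times> V2 \<subseteq> W"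
      using W unfolding openin_prod_topology_alt by meson
    define G where "G = {q \<in> topspace ?C. s < cone_height q \<and> cone_base_point q \<in> V1 \<inter> V2}"
    have gt: "openin ?C {q \<in> topspace ?C. cone_height q \<in> {r<..}}" for r
      by (rule openin_continuous_map_preimage[OF continuous_map_cone_height]) simp
    have "openin (subtopology ?C {q. 0 < cone_height q})
        {q \<in> topspace (subtopology ?C {q. 0 < cone_height q}). cone_base_point q \<in> V1 \<inter> V2}"
      using V12 by (intro openin_continuous_map_preimage[OF continuous_map_cone_base_point]) auto
    then obtain T where T: "openin ?C T"
        "{q \<in> topspace (subtopology ?C {q. 0 < cone_height q}). cone_base_point q \<in> V1 \<inter> V2}
           = T \<inter> {q. 0 < cone_height q}"
      unfolding openin_subtopology by blast
    have "q \<in> G \<longleftrightarrow> q \<in> T \<inter> {q \<in> topspace ?C. cone_height q \<in> {s<..}}" for q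
      using T(2)[unfolded set_eq_iff, rule_format, of q] sab(1) by (auto simp: G_def)
    then have "G = T \<inter> {q \<in> topspace ?C. cone_height q \<in> {s<..}}" by blast
    then have "openin ?C G" using openin_Int[OF T(1) gt[of s]] by simp
    then have "openin X {z \<in> U. \<phi> z \<in> G}" by (rule openin_chart_preimage)
    moreover have "P y z" if "y \<in> U" "\<phi> y \<in> G" "z \<in> U" "\<phi> z \<in> G" for y z
      using that V12(5) by (auto simp: P_def G_def)
    moreover have "\<phi> z0 \<in> G" using False sab chart_in[OF z0] V12 by (simp add: G_def)
    ultimately show ?thesis
      using z0 by (intro bexI[of _ "{z \<in> U. \<phi> z \<in> G}"]) (auto simp: \<C>_def)
  qed
  then have "{z \<in> U. height z \<le> b} \<subseteq> \<Union>\<C>" by blast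
  moreover have "compactin mtopology {z \<in> U. height z \<le> b}"
    using compactin_core[OF sab(3,4)] by (simp only: mtop)
  moreover have "openin mtopology V" if "V \<in> \<C>" for V
    using that by (simp add: \<C>_def mtop)
  ultimately have "\<exists>\<epsilon>>0. \<forall>z\<in>{z \<in> U. height z \<le> b}. \<exists>V\<in>\<C>. mball z \<epsilon> \<subseteq> V"
    by (intro lebesgue_number)
  then obtain \<epsilon> where \<epsilon>: "0 < \<epsilon>" "\<forall>z\<in>{z \<in> U. height z \<le> b}. \<exists>V\<in>\<C>. mball z \<epsilon> \<subseteq> V"
    by blast
  show thesis
  proof (rule that[OF \<epsilon>(1)])
    fix y z assume y: "y \<in> topspace X" "z \<in> U" "height z \<le> b" "d y z < \<epsilon>"
    then obtain V where V: "V \<in> \<C>" "mball z \<epsilon> \<subseteq> V" using \<epsilon>(2) by blast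
    have "y \<in> V" "z \<in> V"
      using y V(2) U_subset \<epsilon>(1) commute[of y z] by (auto simp: in_mball subset_iff)
    then show "y \<in> U \<and> (height z < a \<or> s < height y \<and> (cone_base_point (\<phi> y), cone_base_point (\<phi> z)) \<in> W)"
      using V(1) by (auto simp: \<C>_def P_def)
  qed
qed

text \<open>A map \<open>f\<close> near the identity is read in the chart on the core of height \<open>b\<close>.  It need not be the
  identity on the sphere of height \<open>b\<close>, so it is replaced on the layer \<open>a \<le> height \<le> b\<close> by an
  interpolation \<open>I\<close> between \<open>f\<close> (inner sphere) and the identity (outer sphere): the base
  coordinates are joined by the paths \<open>E\<close>, the heights by convex combination.  The paths are
  constant where \<open>f\<close> agrees with the identity, so fixed points stay fixed, in particular those of
  the cone over \<open>N\<close>.  On the layer both heights exceed \<open>s\<close>, hence so does the interpolated one, and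
  no new point of height \<open>\<le> s\<close> is hit.  A point of the core of height \<open>s\<close> that is missed by \<open>f\<close> would thus be missed
  by a self-map of the cone that fixes the rim and the cone over \<open>N\<close>.\<close>

lemma core_covered:
  assumes surj: "surjection_property (cone_pair L N)" and N: "admissible_base L N"
    and A: "\<phi> ` (U \<inter> A) = open_cone_set N"
    and E_cont: "continuous_map (prod_topology (subtopology (prod_topology L L) W) (top_of_set {0..1::real})) L E"
    and E_0: "\<And>x y. (x, y) \<in> W \<Longrightarrow> E ((x, y), 0) = x"
    and E_1: "\<And>x y. (x, y) \<in> W \<Longrightarrow> E ((x, y), 1) = y"
    and E_diag: "\<And>x t. \<lbrakk>x \<in> topspace L; 0 \<le> t; t \<le> 1\<rbrakk> \<Longrightarrow> E ((x, x), t) = x"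
    and sab: "0 \<le> s" "s < a" "a < b" "b < 1"
    and f: "continuous_map X X f" "\<And>z. z \<in> A \<Longrightarrow> f z = z"
    and close: "\<And>z. \<lbrakk>z \<in> U; height z \<le> b\<rbrakk> \<Longrightarrow> f z \<in> U \<and>
       (height z < a \<or> s < height (f z) \<and> (cone_base_point (\<phi> (f z)), cone_base_point (\<phi> z)) \<in> W)"
  shows "{z \<in> U. height z \<le> s} \<subseteq> f ` topspace X"
proof (rule ccontr)
  assume "\<not> ?thesis"
  then obtain z0 where z0: "z0 \<in> U" "height z0 \<le> s" "z0 \<notin> f ` topspace X" by blast
  let ?C = "cone_space L"
  have b: "0 \<le> b" "0 < b" "b \<le> 1" using sab by auto
  have L_ne: "L \<noteq> trivial_topology"
    using chart_in(1)[OF z0(1)] by (auto simp: topspace_cone_space)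
  define H where "H = (\<lambda>q. \<phi> (f (\<psi> (cone_dilate b q))))"
  define \<tau> where "\<tau> = (\<lambda>q::'b cone_point. (b * cone_height q - a) / (b - a))"
  define I where "I = (\<lambda>q. cone_proj (E ((cone_base_point (H q), cone_base_point q), \<tau> q),
      (1 - \<tau> q) * cone_height (H q) + \<tau> q * (b * cone_height q)))"
  define G where "G = (\<lambda>q. if cone_height q \<le> a / b then H q else I q)"
  \<comment> \<open>\<open>H\<close>, \<open>I\<close> and \<open>G\<close> take their arguments at scale \<open>b\<close>, but their values may lie above height \<open>b\<close>;
    the truncated blow-up brings them back into the cone and inverts the scaling.\<close>
  define g where "g = (\<lambda>q. cone_dilate (1/b) (G q))"
  note dil = dilate_into_chart[OF _ b(1) sab(4)]
  have f_U: "f (\<psi> (cone_dilate b q)) \<in> U" if "q \<in> topspace ?C" for q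
    using close dil[OF that] by simp
  have H_cont: "continuous_map ?C ?C H"
  proof -
    have "continuous_map ?C (subtopology X U) (\<lambda>q. f (\<psi> (cone_dilate b q)))"
      using f_U continuous_map_compose[OF continuous_map_inverse_chart_dilate[OF b(1) sab(4)] f(1)]
      by (auto simp: continuous_map_in_subtopology o_def)
    from continuous_map_compose[OF this continuous_map_chart] show ?thesis
      by (simp add: H_def o_def)
  qed
  have H_in: "H q \<in> topspace ?C" "cone_height (H q) < 1" if "q \<in> topspace ?C" for q
    using chart_in[OF f_U[OF that]] by (auto simp: H_def)
  have ab: "a / b \<le> r \<longleftrightarrow> a \<le> b * r" "r \<le> a / b \<longleftrightarrow> b * r \<le> a" for r
    using b by (auto simp: field_simps)
  have layer: "s < cone_height (H q)" "0 < cone_height q" "(cone_base_point (H q), cone_base_point q) \<in> W"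
      "0 \<le> \<tau> q" "\<tau> q \<le> 1" "cone_base_point q \<in> topspace L"
    if q: "q \<in> topspace ?C" "a / b \<le> cone_height q" for q
  proof -
    have aq: "a \<le> b * cone_height q" using q ab by simp
    have le: "b * cone_height q \<le> b" using b cone_height_bounds[OF q(1)] by (simp add: mult_left_le)
    show pos: "0 < cone_height q" using aq sab b by (metis le_less_trans less_le_trans zero_less_mult_pos)
    have bp: "cone_base_point (cone_dilate b q) = cone_base_point q"
      using q(1) pos le sab by (auto elim!: cone_space_cases simp: min_def)
    show "s < cone_height (H q)" "(cone_base_point (H q), cone_base_point q) \<in> W"
      using close[OF dil(4)[OF q(1)]] aq dil[OF q(1)] bp by (auto simp: H_def)
    show "0 \<le> \<tau> q" "\<tau> q \<le> 1" using aq le sab by (auto simp: \<tau>_def)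
    show "cone_base_point q \<in> topspace L" using q(1) pos by (intro cone_base_point_in) auto
  qed
  have mix: "0 \<le> (1 - \<tau> q) * cone_height (H q) + \<tau> q * (b * cone_height q)"
      "(1 - \<tau> q) * cone_height (H q) + \<tau> q * (b * cone_height q) \<le> 1"
      "s < (1 - \<tau> q) * cone_height (H q) + \<tau> q * (b * cone_height q)"
    if q: "q \<in> topspace ?C" "a / b \<le> cone_height q" for q
  proof -
    have 1: "s < b * cone_height q" using q ab sab by (metis less_le_trans)
    have 2: "b * cone_height q \<le> 1" using b cone_height_bounds[OF q(1)] by (simp add: mult_le_one)
    have 3: "s < cone_height (H q)" "cone_height (H q) \<le> 1" using layer[OF q] H_in[OF q(1)] by auto
    \<comment> \<open>\<open>convex_bound_lt\<close> bounds convex combinations from above, hence the negations.\<close>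
    show *: "s < (1 - \<tau> q) * cone_height (H q) + \<tau> q * (b * cone_height q)"
      using convex_bound_lt[of "- cone_height (H q)" "- s" "- (b * cone_height q)" "1 - \<tau> q" "\<tau> q"]
        1 3 layer[OF q] by auto
    show "0 \<le> (1 - \<tau> q) * cone_height (H q) + \<tau> q * (b * cone_height q)" using * sab by linarith
    show "(1 - \<tau> q) * cone_height (H q) + \<tau> q * (b * cone_height q) \<le> 1"
      using 2 3 layer[OF q] by (intro convex_bound_le) auto
  qed
  have I_cont: "continuous_map (subtopology ?C {q \<in> topspace ?C. a / b \<le> cone_height q}) ?C I"
    unfolding I_def
  proof (rule continuous_map_into_cone)
    let ?Y = "subtopology ?C {q \<in> topspace ?C. a / b \<le> cone_height q}"
    have ht: "continuous_map ?Y euclideanreal cone_height"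
      by (intro continuous_map_from_subtopology continuous_map_cone_height)
    have HY: "continuous_map ?Y ?C H" by (intro continuous_map_from_subtopology H_cont)
    have htH: "continuous_map ?Y euclideanreal (\<lambda>q. cone_height (H q))"
      using continuous_map_compose[OF HY continuous_map_cone_height] by (simp add: o_def)
    have \<tau>_cont: "continuous_map ?Y euclideanreal \<tau>"
      unfolding \<tau>_def using sab
      by (intro continuous_map_real_divide continuous_map_diff continuous_map_real_mult ht) auto
    have HY': "continuous_map ?Y (subtopology ?C {q. 0 < cone_height q}) H"
      using HY layer(1) sab(1) by (fastforce simp: continuous_map_in_subtopology)
    have bH: "continuous_map ?Y L (\<lambda>q. cone_base_point (H q))"
      using continuous_map_compose[OF HY' continuous_map_cone_base_point] by (simp add: o_def)
    have bq: "continuous_map ?Y L cone_base_point"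
      by (rule continuous_map_from_subtopology_mono[OF continuous_map_cone_base_point]) (use layer(2) in auto)
    have "continuous_map ?Y (prod_topology (subtopology (prod_topology L L) W) (top_of_set {0..1}))
        (\<lambda>q. ((cone_base_point (H q), cone_base_point q), \<tau> q))"
      using bH bq \<tau>_cont layer
      by (auto simp: continuous_map_paired continuous_map_in_subtopology)
    from continuous_map_compose[OF this E_cont]
    show "continuous_map ?Y L (\<lambda>q. E ((cone_base_point (H q), cone_base_point q), \<tau> q))"
      by (simp add: o_def)
    show "continuous_map ?Y euclideanreal
        (\<lambda>q. (1 - \<tau> q) * cone_height (H q) + \<tau> q * (b * cone_height q))"
      by (intro continuous_map_add continuous_map_real_mult continuous_map_diff \<tau>_cont htH ht) auto
    show "(1 - \<tau> q) * cone_height (H q) + \<tau> q * (b * cone_height q) \<in> {0..1}" if "q \<in> topspace ?Y" for q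
      using mix that by auto
  qed
  have "continuous_map ?C ?C G"
    unfolding G_def
  proof (rule continuous_map_cases_le)
    show "continuous_map ?C euclideanreal cone_height" by (rule continuous_map_cone_height)
    show "continuous_map (subtopology ?C {q \<in> topspace ?C. cone_height q \<le> a / b}) ?C H"
      by (intro continuous_map_from_subtopology H_cont)
    show "continuous_map (subtopology ?C {q \<in> topspace ?C. a / b \<le> cone_height q}) ?C I" by (rule I_cont)
    fix q assume q: "q \<in> topspace ?C" "cone_height q = a / b"
    then have "\<tau> q = 0" using b by (simp add: \<tau>_def)
    then have "I q = cone_proj (cone_base_point (H q), cone_height (H q))"
      using layer(3)[of q] q by (simp add: I_def E_0 del: cone_proj.simps)
    also have "\<dots> = H q"
      using H_in(1)[OF q(1)] by (cases rule: cone_space_cases) auto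
    finally show "H q = I q" by simp
  qed simp
  then have g_cont: "continuous_map ?C ?C g"
    using continuous_map_compose[of ?C ?C G ?C "cone_dilate (1/b)"] continuous_map_cone_dilate[of "1/b" L] b
    by (simp add: g_def o_def)
  have dil_proj: "cone_dilate b q = cone_proj (cone_base_point q, b * cone_height q)"
    if "q \<in> topspace ?C" for q
    using that
  proof (cases rule: cone_space_cases)
    case (1 x t)
    then have "min 1 (b * t) = b * t" using b mult_le_one[of b t] by (simp add: min_def)
    then show ?thesis using 1 by auto
  qed
  have g_fix: "g q = q" if "q \<in> topspace ?C" "G q = cone_dilate b q" for q
    using that cone_dilate_inverse b by (simp add: g_def)
  have g_rim: "g q = q" if "q \<in> cone_rim L" for q
  proof (rule g_fix)
    have q: "q \<in> topspace ?C" "cone_height q = 1" using that by (auto simp: cone_rim_eq)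
    then show "q \<in> topspace ?C" by simp
    have "a / b < 1" using sab b by simp
    then have "G q = I q" using q by (simp add: G_def)
    also have "\<tau> q = 1" using sab q by (simp add: \<tau>_def)
    then have "I q = cone_proj (cone_base_point q, b * cone_height q)"
      using layer(3)[of q] q \<open>a / b < 1\<close> by (simp add: I_def E_1 del: cone_proj.simps)
    finally show "G q = cone_dilate b q" using dil_proj q by simp
  qed
  have g_N: "g q = q" if "q \<in> cone_set N" for q
  proof (rule g_fix)
    show q: "q \<in> topspace ?C"
    proof (cases N)
      case Odot
      then show ?thesis using that L_ne by simp
    next
      case (Base K)
      then show ?thesis
        using that N compactin_subset_topspace[of L K] by (auto simp: topspace_cone_space)
    qed
    have "cone_dilate b q \<in> open_cone_set N"
      using cone_dilate_cone_set[OF that b(1)] dil[OF q] by (simp add: open_cone_set_eq)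
    then have "cone_dilate b q \<in> \<phi> ` (U \<inter> A)" by (simp only: A)
    then obtain z where z: "z \<in> U" "z \<in> A" "\<phi> z = cone_dilate b q" by force
    then have "\<psi> (cone_dilate b q) = z" using inverse_chart_chart[of z] by simp
    then have H: "H q = cone_dilate b q" using z f(2)[of z] by (simp add: H_def)
    show "G q = cone_dilate b q"
    proof (cases "cone_height q \<le> a / b")
      case False
      then have lay: "a / b \<le> cone_height q" by simp
      have "b * cone_height q \<noteq> 0" using layer(2)[OF q lay] b by simp
      then have "cone_base_point (H q) = cone_base_point q"
        using H dil_proj[OF q] by (simp del: cone_proj.simps)
      moreover have "cone_height (H q) = b * cone_height q" using H dil[OF q] by simp
      ultimately have "I q = cone_proj (cone_base_point q, (1 - \<tau> q) * (b * cone_height q) + \<tau> q * (b * cone_height q))"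
        using layer[OF q lay] by (simp add: I_def E_diag del: cone_proj.simps)
      also have "(1 - \<tau> q) * (b * cone_height q) + \<tau> q * (b * cone_height q) = b * cone_height q"
        by (simp add: left_diff_distrib)
      finally show ?thesis using False dil_proj[OF q] by (simp add: G_def)
    qed (simp add: G_def H)
  qed
  have "g ` topspace ?C = topspace ?C"
    using surj g_cont g_rim g_N unfolding surjection_property_def cone_pair_def by auto
  moreover have "cone_dilate (1/b) (\<phi> z0) \<in> topspace ?C"
    using chart_in[OF z0(1)] b by (intro cone_dilate_in) auto
  ultimately have "cone_dilate (1/b) (\<phi> z0) \<in> g ` topspace ?C" by simp
  then obtain q where q: "q \<in> topspace ?C" "cone_dilate (1/b) (G q) = cone_dilate (1/b) (\<phi> z0)"
    unfolding g_def by force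
  have "G q \<in> topspace ?C"
    using \<open>continuous_map ?C ?C G\<close> q(1) unfolding continuous_map_def by auto
  then have Gq: "G q = \<phi> z0"
    using q(2) chart_in[OF z0(1)] z0(2) sab b by (intro cone_dilate_inj_below[of "\<phi> z0" L "G q" b]) auto
  show False
  proof (cases "cone_height q \<le> a / b")
    case True
    then have "\<phi> (f (\<psi> (cone_dilate b q))) = \<phi> z0" using Gq by (simp add: G_def H_def)
    then have "f (\<psi> (cone_dilate b q)) = z0"
      using f_U[OF q(1)] z0(1) by (metis inverse_chart_chart)
    then show False using z0(3) dil(4)[OF q(1)] U_subset by blast
  next
    case False
    then have "cone_height (G q) > s" using mix(3)[of q] q(1) by (simp add: G_def I_def del: cone_proj.simps)
    then show False using Gq z0(2) by simp
  qed
qed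

end

section \<open>The equivalence\<close>

lemma finitely_conical_charts:
  assumes "compact_pair (X, A)" "finitely_conical_witnessed (X, A) n L N"
  obtains U \<phi> \<psi> where "(\<Union>i\<le>n. U i) = topspace X"
    "\<And>i. i \<le> n \<Longrightarrow> conical_chart X (U i) (L i) (\<phi> i) (\<psi> i)"
    "\<And>i. i \<le> n \<Longrightarrow> \<phi> i ` (U i \<inter> A) = open_cone_set (N i)"
    "\<And>i. i \<le> n \<Longrightarrow> admissible_base (L i) (N i)"
proof -
  have L: "\<forall>i\<le>n. compact_metrizable (L i) \<and> admissible_base (L i) (N i)"
    and ex: "\<exists>U f. (\<forall>i\<le>n. openin X (U i)) \<and> (\<Union>i\<le>n. U i) = topspace X \<and>
        (\<forall>i\<le>n. homeomorphic_map (subtopology X (U i)) (open_cone (L i)) (f i) \<and>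
                f i ` (U i \<inter> A) = open_cone_set (N i))"
    using assms(2) unfolding finitely_conical_witnessed_def prod.case by blast+
  obtain U \<phi> where U: "(\<forall>i\<le>n. openin X (U i)) \<and> (\<Union>i\<le>n. U i) = topspace X \<and>
      (\<forall>i\<le>n. homeomorphic_map (subtopology X (U i)) (open_cone (L i)) (\<phi> i) \<and>
         \<phi> i ` (U i \<inter> A) = open_cone_set (N i))"
    using ex by (elim exE)
  have "\<exists>\<psi>. i \<le> n \<longrightarrow> homeomorphic_maps (subtopology X (U i)) (open_cone (L i)) (\<phi> i) \<psi>" for i
    using U by (simp add: homeomorphic_map_maps)
  then obtain \<psi> where \<psi>:
      "\<And>i. i \<le> n \<longrightarrow> homeomorphic_maps (subtopology X (U i)) (open_cone (L i)) (\<phi> i) (\<psi> i)"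
    by metis
  have "Hausdorff_space X"
    using assms(1) by (simp add: compact_pair_def compact_metrizable_def metrizable_imp_Hausdorff_space)
  show thesis
  proof (rule that[of U \<phi> \<psi>])
    show "(\<Union>i\<le>n. U i) = topspace X" using U by simp
    fix i assume i: "i \<le> n"
    show "conical_chart X (U i) (L i) (\<phi> i) (\<psi> i)"
    proof
      show "compact_space (L i)" using L i by (simp add: compact_metrizable_def)
    qed (use \<open>Hausdorff_space X\<close> U \<psi> i in simp_all)
    show "\<phi> i ` (U i \<inter> A) = open_cone_set (N i)" "admissible_base (L i) (N i)"
      using U L i by simp_all
  qed
qed

theorem theorem3p1:
  fixes X :: "'a topology" and A :: "'a set" and d :: "'a \<Rightarrow> 'a \<Rightarrow> real"
    and n :: nat and L :: "nat \<Rightarrow> 'b topology" and N :: "nat \<Rightarrow> 'b cone_base"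
  assumes "compact_pair (X, A)"
    and "compatible_metric X d"
    and "finitely_conical_witnessed (X, A) n L N"
    and "\<And>i. i \<le> n \<Longrightarrow> compact_ANR (L i)"
  shows "(\<exists>\<epsilon>>0. eps_surjection_property d \<epsilon> (X, A)) \<longleftrightarrow>
         (\<forall>i\<le>n. surjection_property (cone_pair (L i) (N i)))"
proof -
  interpret Metric_space "topspace X" d using assms(2) by (simp add: compatible_metric_def)
  have mtop: "mtopology = X" using assms(2) by (simp add: compatible_metric_def)
  obtain U \<phi> \<psi> where U: "(\<Union>i\<le>n. U i) = topspace X"
    and chart: "\<And>i. i \<le> n \<Longrightarrow> conical_chart X (U i) (L i) (\<phi> i) (\<psi> i)"
    and A: "\<And>i. i \<le> n \<Longrightarrow> \<phi> i ` (U i \<inter> A) = open_cone_set (N i)"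
    and N: "\<And>i. i \<le> n \<Longrightarrow> admissible_base (L i) (N i)"
    using finitely_conical_charts[OF assms(1,3)] by blast
  show ?thesis
  proof
    assume "\<exists>\<epsilon>>0. eps_surjection_property d \<epsilon> (X, A)"
    then obtain \<epsilon> where \<epsilon>: "0 < \<epsilon>" "eps_surjection_property d \<epsilon> (X, A)" by blast
    show "\<forall>i\<le>n. surjection_property (cone_pair (L i) (N i))"
    proof (intro allI impI, rule ccontr)
      fix i assume i: "i \<le> n" and "\<not> surjection_property (cone_pair (L i) (N i))"
      then obtain g where g: "continuous_map (cone_space (L i)) (cone_space (L i)) g"
          "\<forall>q\<in>cone_rim (L i) \<union> cone_set (N i). g q = q"
          "g ` topspace (cone_space (L i)) \<noteq> topspace (cone_space (L i))"
        unfolding surjection_property_def cone_pair_def by auto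
      have "g ` topspace (cone_space (L i)) \<subseteq> topspace (cone_space (L i))"
        using g(1) by (rule continuous_map_image_subset_topspace)
      then obtain p where p: "p \<in> topspace (cone_space (L i))" "p \<notin> g ` topspace (cone_space (L i))"
        using g(3) by blast
      interpret conical_chart X "U i" "L i" "\<phi> i" "\<psi> i" by (rule chart[OF i])
      let ?V = "mball (\<psi> i Tip) (\<epsilon>/2)"
      have "L i \<noteq> trivial_topology" using p(1) by (auto simp: topspace_cone_space)
      then have "\<psi> i Tip \<in> topspace X" using inverse_chart_in[of Tip] U_subset by auto
      then have V: "openin X ?V" "\<psi> i Tip \<in> ?V" using \<epsilon>(1) openin_mball mtop by auto
      obtain f where f: "continuous_map X X f" "\<And>a. a \<in> A \<Longrightarrow> f a = a" "f ` topspace X \<noteq> topspace X"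
          "\<And>z. z \<in> topspace X \<Longrightarrow> f z = z \<or> z \<in> ?V \<and> f z \<in> ?V"
        using nonsurjective_cone_map_transfers[OF g(1) _ _ p A[OF i] V] g(2) by blast
      have "d (f z) z < \<epsilon>" if "z \<in> topspace X" for z
      proof (cases "f z = z")
        case True
        then show ?thesis using \<epsilon>(1) that by simp
      next
        case False
        then have *: "z \<in> ?V" "f z \<in> ?V" using f(4)[OF that] by auto
        then have "d (f z) z \<le> d (\<psi> i Tip) (f z) + d (\<psi> i Tip) z"
          by (metis commute in_mball triangle)
        then show ?thesis using * by (auto simp: in_mball)
      qed
      then show False using \<epsilon>(2) f unfolding eps_surjection_property_def by auto
    qed
  next
    assume surj: "\<forall>i\<le>n. surjection_property (cone_pair (L i) (N i))"
    \<comment> \<open>Each point has a neighbourhood that is covered by all maps sufficiently near the identity;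
      compactness of \<open>X\<close> makes the bound uniform.\<close>
    define near where "near = (\<lambda>\<epsilon> f. continuous_map X X f \<and> (\<forall>z\<in>A. f z = z) \<and> (\<forall>z\<in>topspace X. d (f z) z < \<epsilon>))"
    define covered where "covered = (\<lambda>V \<epsilon>. 0 < \<epsilon> \<and> (\<forall>f. near \<epsilon> f \<longrightarrow> V \<subseteq> f ` topspace X))"
    have local: "\<exists>V \<epsilon>. openin X V \<and> z \<in> V \<and> covered V \<epsilon>" if "z \<in> topspace X" for z
    proof -
      have "z \<in> (\<Union>i\<le>n. U i)" using that by (simp only: U)
      then obtain i where i: "i \<le> n" "z \<in> U i" by auto
      interpret conical_chart X "U i" "L i" "\<phi> i" "\<psi> i" by (rule chart[OF i(1)])
      \<comment> \<open>Any \<open>height z < s < a < b < 1\<close> will do.\<close>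
      define s where "s = (height z + 1) / 2"
      define a where "a = (2 * s + 1) / 3"
      define b where "b = (s + 2) / 3"
      have s: "height z < s" "0 \<le> s" "s < 1" using chart_in[OF i(2)] by (auto simp: s_def)
      then have sab: "0 \<le> s" "s < a" "a < b" "0 < b" "b < 1" by (auto simp: a_def b_def)
      obtain W E where WE: "openin (prod_topology (L i) (L i)) W" "\<And>x. x \<in> topspace (L i) \<Longrightarrow> (x, x) \<in> W"
          "continuous_map (prod_topology (subtopology (prod_topology (L i) (L i)) W) (top_of_set {0..1::real})) (L i) E"
          "\<And>x y. (x, y) \<in> W \<Longrightarrow> E ((x, y), 0) = x" "\<And>x y. (x, y) \<in> W \<Longrightarrow> E ((x, y), 1) = y"
          "\<And>x t. \<lbrakk>x \<in> topspace (L i); 0 \<le> t; t \<le> 1\<rbrakk> \<Longrightarrow> E ((x, x), t) = x"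
        using compact_ANR_locally_equiconnected[OF assms(4)[OF i(1)]] by blast
      obtain \<epsilon> where \<epsilon>: "0 < \<epsilon>"
          "\<And>y z. \<lbrakk>y \<in> topspace X; z \<in> U i; height z \<le> b; d y z < \<epsilon>\<rbrakk> \<Longrightarrow> y \<in> U i \<and>
             (height z < a \<or> s < height y \<and> (cone_base_point (\<phi> i y), cone_base_point (\<phi> i z)) \<in> W)"
        using close_points_share_coordinates[OF assms(2) WE(1,2) sab(1,2,4,5)] by blast
      have "{z \<in> U i. height z < s} \<subseteq> f ` topspace X" if "near \<epsilon> f" for f
      proof -
        have f: "continuous_map X X f" "\<And>z. z \<in> A \<Longrightarrow> f z = z" "\<And>z. z \<in> topspace X \<Longrightarrow> d (f z) z < \<epsilon>"
          using that by (auto simp: near_def)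
        have "f z \<in> U i \<and> (height z < a \<or> s < height (f z) \<and>
            (cone_base_point (\<phi> i (f z)), cone_base_point (\<phi> i z)) \<in> W)"
          if "z \<in> U i" "height z \<le> b" for z
          using that f U_subset \<epsilon>(2)[of "f z" z] unfolding continuous_map_def by blast
        from core_covered[OF surj[rule_format, OF i(1)] N[OF i(1)] A[OF i(1)] WE(3-6) sab(1-3,5) f(1,2) this]
        show ?thesis by force
      qed
      then show ?thesis
        using i(2) s(1) \<epsilon>(1) openin_open_core[of s]
        by (intro exI[of _ "{z \<in> U i. height z < s}"] exI[of _ \<epsilon>]) (auto simp: covered_def)
    qed
    define \<C> where "\<C> = {V. openin X V \<and> (\<exists>\<epsilon>. covered V \<epsilon>)}"
    have "compactin X (topspace X)"
      using assms(1) by (auto simp: compact_pair_def compact_metrizable_def compact_space_def)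
    moreover have "topspace X \<subseteq> \<Union>\<C>" using local unfolding \<C>_def by blast
    ultimately obtain \<F> where \<F>: "finite \<F>" "\<F> \<subseteq> \<C>" "topspace X \<subseteq> \<Union>\<F>"
      using compactinD[of X "topspace X" \<C>] unfolding \<C>_def by blast
    have "\<forall>V\<in>\<F>. \<exists>\<epsilon>. covered V \<epsilon>" using \<F>(2) by (auto simp: \<C>_def)
    then obtain e where e: "\<And>V. V \<in> \<F> \<Longrightarrow> covered V (e V)" by metis
    define \<epsilon> where "\<epsilon> = Min (insert 1 (e ` \<F>))"
    have "0 < \<epsilon>" using \<F>(1) e by (auto simp: \<epsilon>_def covered_def)
    moreover have "f ` topspace X = topspace X" if "near \<epsilon> f" for f
    proof
      show "f ` topspace X \<subseteq> topspace X"
        using that by (simp add: near_def continuous_map_image_subset_topspace)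
      have "V \<subseteq> f ` topspace X" if V: "V \<in> \<F>" for V
      proof -
        have "\<epsilon> \<le> e V" using \<F>(1) V by (simp add: \<epsilon>_def)
        then have "near (e V) f" using \<open>near \<epsilon> f\<close> by (force simp: near_def)
        then show ?thesis using e[OF V] by (simp add: covered_def)
      qed
      then show "topspace X \<subseteq> f ` topspace X" using \<F>(3) by blast
    qed
    ultimately show "\<exists>\<epsilon>>0. eps_surjection_property d \<epsilon> (X, A)"
      unfolding eps_surjection_property_def near_def by auto
  qed
qed

end
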